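(* Let $\mathcal{A}$ be the following strategy, which uses no knowledge of $d$ or $v$: with $u_i=2^{3\cdot2^i\sqrt{i+1}-1}$ and $v_i=1-u_i^{-1}$, starting with $t=0$, for $i=0,1,2,\dots$ the robot sets $x_i=u_i(1+v_it)$, moves at speed $1$ from the origin to position $(-1)^ix_i$ and back to the origin, and updates $t\leftarrow t+2x_i$. Then for every evasiveness $u\ge1$ and initial distance $d\ge1$, $$CR_{\mathcal{A}}(u,d)\le\begin{cases}1+\frac8d & \text{if } ud\le4,\\[2pt] 1+\frac1d\left(56.18\,(ud)^{4-(\log_2\log_2(ud))^{-2}}-1\right) & \text{if } ud>4.\end{cases}$$
   Context: Search model: a robot starts at the origin of the real line at time $0$ with maximum speed $1$. A target starts at distance $d\ge1$ from the origin on one of the two sides and moves away from the origin at constant speed $v\in[0,1)$; neither $d$, $v$, nor the side is known to the searcher. The evasiveness is $u=\frac1{1-v}\in[1,\infty)$, $v=1-\frac1u$. For a strategy (robot position function) $\mathcal{A}:[0,\infty)\to\mathbb{R}$ and $\sigma\in\{0,1\}$, $T^\sigma_{\mathcal{A}}(u,d)=\inf\{t\ge0:\mathcal{A}(t)=(-1)^\sigma(d+(1-\frac1u)t)\}$, $CR^\sigma_{\mathcal{A}}(u,d)=T^\sigma_{\mathcal{A}}(u,d)/(ud)$ and $CR_{\mathcal{A}}(u,d)=\max(CR^0_{\mathcal{A}}(u,d),CR^1_{\mathcal{A}}(u,d))$. *)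

theory Defs
  imports Complex_Main "HOL-Library.Extended_Real"
begin

text \<open>Search for an escaping target on the line. A strategy is a position function of time, only
  its values at times \<open>t \<ge> 0\<close> matter. The capture time takes values in \<open>ereal\<close>, so that it is
  \<open>\<infinity>\<close> if the target is never met.\<close>

definition target_pos :: "nat \<Rightarrow> real \<Rightarrow> real \<Rightarrow> real \<Rightarrow> real" where
  "target_pos \<sigma> u d t = (-1) ^ \<sigma> * (d + (1 - 1 / u) * t)"

definition capture_time :: "(real \<Rightarrow> real) \<Rightarrow> nat \<Rightarrow> real \<Rightarrow> real \<Rightarrow> ereal" where
  "capture_time A \<sigma> u d = Inf (ereal ` {t. t \<ge> 0 \<and> A t = target_pos \<sigma> u d t})"

definition comp_ratio_side :: "(real \<Rightarrow> real) \<Rightarrow> nat \<Rightarrow> real \<Rightarrow> real \<Rightarrow> ereal" where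
  "comp_ratio_side A \<sigma> u d = capture_time A \<sigma> u d / ereal (u * d)"

definition comp_ratio :: "(real \<Rightarrow> real) \<Rightarrow> real \<Rightarrow> real \<Rightarrow> ereal" where
  "comp_ratio A u d = max (comp_ratio_side A 0 u d) (comp_ratio_side A 1 u d)"

definition evas :: "nat \<Rightarrow> real" where
  "evas i = 2 powr (3 * 2 ^ i * sqrt (real i + 1) - 1)"

definition speed :: "nat \<Rightarrow> real" where
  "speed i = 1 - inverse (evas i)"

text \<open>\<open>round_start i\<close> is the value of the variable \<open>t\<close> at the beginning of round \<open>i\<close>, and
  \<open>excursion i\<close> is the distance \<open>x\<^sub>i\<close> travelled from the origin in that round.\<close>

fun round_start :: "nat \<Rightarrow> real" where
  "round_start 0 = 0"
| "round_start (Suc i) =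
     round_start i + 2 * (evas i * (1 + speed i * round_start i))"

definition excursion :: "nat \<Rightarrow> real" where
  "excursion i = evas i * (1 + speed i * round_start i)"

definition round_pos :: "nat \<Rightarrow> real \<Rightarrow> real" where
  "round_pos i s = (-1) ^ i * (if s \<le> excursion i then s else 2 * excursion i - s)"

definition round_of :: "real \<Rightarrow> nat" where
  "round_of t = (LEAST i. t < round_start (Suc i))"

definition search_strategy :: "real \<Rightarrow> real" where
  "search_strategy t = round_pos (round_of t) (t - round_start (round_of t))"

lemma evas_ge_4: "evas i \<ge> 4"
proof -
  have "(1::real) * 1 \<le> 2 ^ i * sqrt (real i + 1)"
    by (intro mult_mono) auto
  then have "(2::real) powr 2 \<le> evas i"
    unfolding evas_def by (intro powr_mono) auto
  then show ?thesis by simp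
qed

lemma speed_nonneg: "speed i \<ge> 0"
  using evas_ge_4[of i] by (simp add: speed_def field_simps)

lemma round_start_Suc_excursion:
  "round_start (Suc i) = round_start i + 2 * excursion i"
  by (simp add: excursion_def)

lemma round_start_nonneg: "round_start i \<ge> 0"
proof (induction i)
  case (Suc i)
  then show ?case using evas_ge_4[of i] speed_nonneg[of i] by simp
qed simp

lemma excursion_ge_4: "excursion i \<ge> 4"
proof -
  have "4 * 1 \<le> evas i * (1 + speed i * round_start i)"
    using evas_ge_4[of i] speed_nonneg[of i] round_start_nonneg[of i]
    by (intro mult_mono) auto
  then show ?thesis by (simp add: excursion_def)
qed

lemma round_start_strict_mono: "strict_mono round_start"
proof (rule strict_mono_Suc_iff[THEN iffD2], intro allI)
  fix i show "round_start i < round_start (Suc i)"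
    using excursion_ge_4[of i] round_start_Suc_excursion[of i] by linarith
qed

lemma search_strategy_round:
  assumes "round_start i \<le> t" "t \<le> round_start (Suc i)"
  shows "search_strategy t = round_pos i (t - round_start i)"
proof (cases "t < round_start (Suc i)")
  case True
  have "round_of t = i"
    unfolding round_of_def
  proof (rule Least_equality)
    fix j assume j: "t < round_start (Suc j)"
    have "round_start i < round_start (Suc j)" using assms(1) j by linarith
    then show "i \<le> j"
      using strict_mono_less[OF round_start_strict_mono, of i "Suc j"] by simp
  qed (fact True)
  then show ?thesis by (simp add: search_strategy_def)
next
  case False
  then have t: "t = round_start (Suc i)" using assms(2) by linarith
  have "round_of t = Suc i"
    unfolding round_of_def t
    using strict_mono_less[OF round_start_strict_mono]
    by (intro Least_equality) (auto simp del: round_start.simps)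
  then show ?thesis
    using excursion_ge_4[of i] excursion_ge_4[of "Suc i"] t
    by (simp add: search_strategy_def round_pos_def round_start_Suc_excursion
             del: round_start.simps)
qed

end

theory Submission
  imports Defs
begin

text \<open>If \<open>u d \<le> u\<^sub>i\<close> and round \<open>i\<close> goes to the correct side, the target is met during that round, at
  time \<open>u (d + t\<^sub>i)\<close> where \<open>t\<^sub>i\<close> is the start of the round. If \<open>n\<close> is least with \<open>u d \<le> u\<^sub>n\<close>, then round
  \<open>n\<close> or \<open>n + 1\<close> is such a round, so the ratio is at most \<open>1 + t\<^sub>n\<^sub>+\<^sub>1 / d\<close>, while \<open>u d > u\<^sub>n\<^sub>-\<^sub>1\<close>. From
  \<open>t\<^sub>i\<^sub>+\<^sub>1 + 1 \<le> 2 u\<^sub>i (t\<^sub>i + 1)\<close> one gets \<open>t\<^sub>n\<^sub>+\<^sub>1 + 1 \<le> 9/8 * 2 powr (3 S\<^sub>n)\<close> with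
  \<open>S\<^sub>n = (\<Sum>j\<le>n. 2 ^ j * sqrt (j + 1))\<close>. The concavity of the square root yields
  \<open>S\<^sub>n \<le> 2 ^ (n + 1) * (sqrt n - 1 / (4 n sqrt n)) + 1/2\<close> for \<open>n \<ge> 2\<close>, and the negative second-order
  term pays for the \<open>(log\<^sub>2 log\<^sub>2 (u d))\<^sup>-\<^sup>2\<close> in the exponent.\<close>

text \<open>At time \<open>u * (d + round_start i)\<close> the target's distance from the origin
  equals the time \<open>s\<close> elapsed since the round began, so the robot meets it on the
  outward leg if \<open>s \<le> excursion i\<close>. Since \<open>d \<ge> 1\<close>,
  \<open>u * d \<le> evas i\<close> also bounds \<open>u\<close> itself.\<close>

lemma capture_time_le_round:
  assumes "u \<ge> 1" "d \<ge> 1" "u * d \<le> evas i" "even i \<longleftrightarrow> even \<sigma>"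
  shows "capture_time search_strategy \<sigma> u d \<le> ereal (u * (d + round_start i))"
proof -
  let ?T = "round_start i"
  define t where "t = u * (d + ?T)"
  define s where "s = u * d + (u - 1) * ?T"
  have t: "t = ?T + s" by (simp add: t_def s_def algebra_simps)
  have s0: "s \<ge> 0" using assms round_start_nonneg[of i] by (simp add: s_def)
  have "u \<le> u * d" using assms by simp
  then have "u \<le> evas i" using assms(3) by linarith
  then have "(u - 1) * ?T \<le> (evas i - 1) * ?T"
    using round_start_nonneg[of i] by (intro mult_right_mono) auto
  moreover have "excursion i = evas i + (evas i - 1) * ?T"
    using evas_ge_4[of i] by (simp add: excursion_def speed_def field_simps)
  ultimately have s1: "s \<le> excursion i" using assms by (simp add: s_def)
  have "search_strategy t = round_pos i s"
    using search_strategy_round[of i t] s0 s1 excursion_ge_4[of i] t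
    by (simp add: round_start_Suc_excursion del: round_start.simps)
  also have "\<dots> = (-1) ^ \<sigma> * s"
    using s1 assms(4) by (cases "even i") (auto simp: round_pos_def)
  also have "s = d + (1 - 1 / u) * t"
    using assms by (simp add: s_def t_def field_simps)
  finally have "search_strategy t = target_pos \<sigma> u d t" by (simp add: target_pos_def)
  moreover have "t \<ge> 0" using t s0 round_start_nonneg[of i] by simp
  ultimately show ?thesis
    unfolding capture_time_def t_def by (intro Inf_lower) auto
qed

lemma evas_mono: "i \<le> j \<Longrightarrow> evas i \<le> evas j"
  unfolding evas_def
  by (intro powr_mono diff_right_mono mult_mono power_increasing) auto

lemma evas_unbounded: "\<exists>i. x \<le> evas i"
proof -
  obtain i where i: "x < 2 ^ i" using real_arch_pow[of 2 x] by auto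
  have "real i + 1 \<le> 2 ^ i" using less_exp[of i] 
    by (metis Suc_leI of_nat_Suc of_nat_le_iff of_nat_numeral of_nat_power add.commute)
  moreover have "(2::real) ^ i * 1 \<le> 2 ^ i * sqrt (real i + 1)"
    by (intro mult_left_mono) auto
  ultimately have "real i \<le> 3 * 2 ^ i * sqrt (real i + 1) - 1" by linarith
  then have "2 powr real i \<le> evas i" unfolding evas_def by (intro powr_mono) auto
  with i have "x \<le> evas i" by (simp add: powr_realpow)
  then show ?thesis ..
qed

lemma comp_ratio_le_round:
  assumes "u \<ge> 1" "d \<ge> 1" "u * d \<le> evas n"
  shows "comp_ratio search_strategy u d \<le> ereal (1 + round_start (Suc n) / d)"
proof -
  have "comp_ratio_side search_strategy \<sigma> u d \<le> ereal (1 + round_start (Suc n) / d)" for \<sigma>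
  proof -
    obtain i where i: "n \<le> i" "i \<le> Suc n" "even i \<longleftrightarrow> even \<sigma>"
      by (metis even_Suc le_Suc_eq order_refl)
    have "capture_time search_strategy \<sigma> u d \<le> ereal (u * (d + round_start i))"
      using assms i evas_mono[of n i] by (intro capture_time_le_round) auto
    \<comment> \<open>The later of the two candidate rounds gives one bound valid for both
      sides.\<close>
    also have "\<dots> \<le> ereal (u * (d + round_start (Suc n)))"
      using assms i strict_mono_less_eq[OF round_start_strict_mono]
      by (simp del: round_start.simps)
    finally have "comp_ratio_side search_strategy \<sigma> u d
        \<le> ereal (u * (d + round_start (Suc n))) / ereal (u * d)"
      unfolding comp_ratio_side_def using assms by (intro ereal_divide_right_mono) auto
    also have "\<dots> = ereal (1 + round_start (Suc n) / d)"
      using assms by (simp add: field_simps del: round_start.simps)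
    finally show ?thesis .
  qed
  then show ?thesis by (simp add: comp_ratio_def del: round_start.simps)
qed

lemma round_start_Suc_le:
  "round_start (Suc n) + 1 \<le> 9 / 8 * 2 powr (3 * (\<Sum>j\<le>n. 2 ^ j * sqrt (real j + 1)))"
proof (induction n)
  case 0
  have "(2::real) powr 3 = 8" "(2::real) powr 2 = 4" by simp_all
  then show ?case by (simp add: evas_def)
next
  case (Suc n)
  let ?T = "round_start (Suc n)" and ?e = "evas (Suc n)"
  have T: "?T \<ge> 1"
    using round_start_Suc_excursion[of n] excursion_ge_4[of n] round_start_nonneg[of n] by linarith
  have "round_start (Suc (Suc n)) + 1 = 2 * ?e * (?T + 1) + 1 - ?T"
    using evas_ge_4[of "Suc n"]
    by (subst round_start.simps(2)) (simp add: speed_def field_simps del: round_start.simps)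
  also have "\<dots> \<le> 2 * ?e * (?T + 1)" using T by linarith
  also have "\<dots> \<le> 2 * ?e * (9 / 8 * 2 powr (3 * (\<Sum>j\<le>n. 2 ^ j * sqrt (real j + 1))))"
    using Suc.IH evas_ge_4[of "Suc n"] by (intro mult_left_mono) auto
  also have "2 * ?e = 2 powr (3 * (2 ^ Suc n * sqrt (real (Suc n) + 1)))"
    by (simp add: evas_def powr_diff mult.assoc)
  finally show ?case
    by (simp add: powr_add[symmetric] algebra_simps del: round_start.simps)
qed

text \<open>The subtracted term is the leading Taylor term of the second difference. After squaring,
  \<open>sqrt (x\<^sup>2 - 1) \<le> x - 1 / (2 * x)\<close> bounds the left side by
  \<open>4 * x - 1 / x\<close>; the right side exceeds this by a square.\<close>

lemma sqrt_second_difference: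
  fixes x :: real
  assumes "x \<ge> 1"
  shows "sqrt (x + 1) + sqrt (x - 1) \<le> 2 * sqrt x - 1 / (4 * x * sqrt x)"
proof (rule power2_le_imp_le)
  have "sqrt (x\<^sup>2 - 1) \<le> x - 1 / (2 * x)"
  proof (rule real_le_lsqrt)
    show "0 \<le> x - 1 / (2 * x)" using assms mult_mono[of 1 x 1 x] by (simp add: field_simps)
    show "x\<^sup>2 - 1 \<le> (x - 1 / (2 * x))\<^sup>2" using assms by (simp add: power2_diff)
  qed
  moreover have "sqrt (x + 1) * sqrt (x - 1) = sqrt (x\<^sup>2 - 1)"
    by (simp add: real_sqrt_mult[symmetric] algebra_simps power2_eq_square)
  ultimately have "(sqrt (x + 1) + sqrt (x - 1))\<^sup>2 \<le> 4 * x - 1 / x"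
    using assms by (simp add: power2_sum)
  also have "\<dots> \<le> 4 * x - 1 / x + (1 / (4 * x * sqrt x))\<^sup>2" by simp
  also have "\<dots> = (2 * sqrt x - 1 / (4 * x * sqrt x))\<^sup>2"
    using assms by (simp add: power2_diff power_mult_distrib)
  finally show "(sqrt (x + 1) + sqrt (x - 1))\<^sup>2 \<le> (2 * sqrt x - 1 / (4 * x * sqrt x))\<^sup>2" .
  have "1 * 1 \<le> x * sqrt x" using assms by (intro mult_mono) auto
  then have "1 / (4 * x * sqrt x) \<le> 1" using assms by (simp add: divide_le_eq)
  moreover have "1 \<le> sqrt x" using assms by simp
  ultimately show "0 \<le> 2 * sqrt x - 1 / (4 * x * sqrt x)" by linarith
qed

text \<open>The induction step needs the correction at \<open>m + 1\<close> twice: once from the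
  second difference, once from the correction at \<open>m\<close>, which is at least as large. The
  slack 1/2 is there for the base case and is carried along unchanged.\<close>

lemma sum_pow2_sqrt_le:
  assumes "n \<ge> 2"
  shows "(\<Sum>j\<le>n. 2 ^ j * sqrt (real j + 1))
    \<le> 2 ^ Suc n * (sqrt n - 1 / (4 * real n * sqrt n)) + 1 / 2"
  using assms
proof (induction n rule: dec_induct)
  case base
  have "sqrt 3 \<le> 1.733" by (rule real_le_lsqrt) (auto simp: power2_eq_square)
  moreover have "sqrt 2 \<ge> 1.414" by (rule real_le_rsqrt) (auto simp: power2_eq_square)
  moreover have "8 * (sqrt 2 - 1 / (4 * 2 * sqrt 2)) = 15 / 2 * sqrt 2"
    by (simp add: field_simps)
  moreover have "(\<Sum>j\<le>2. 2 ^ j * sqrt (real j + 1)) = 1 + 2 * sqrt 2 + 4 * sqrt 3"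
    by (simp add: numeral_2_eq_2)
  ultimately show ?case by simp
next
  case (step m)
  let ?x = "real m + 1"
  have "4 * real m * sqrt m \<le> 4 * ?x * sqrt ?x" by (intro mult_mono) auto
  then have "1 / (4 * ?x * sqrt ?x) \<le> 1 / (4 * real m * sqrt m)"
    using step by (intro divide_left_mono) auto
  moreover have "sqrt (?x + 1) + sqrt m \<le> 2 * sqrt ?x - 1 / (4 * ?x * sqrt ?x)"
    using sqrt_second_difference[of ?x] by simp
  ultimately have "2 ^ Suc m * (sqrt m - 1 / (4 * real m * sqrt m) + sqrt (?x + 1))
      \<le> 2 ^ Suc m * (2 * (sqrt ?x - 1 / (4 * ?x * sqrt ?x)))"
    by (intro mult_left_mono) auto
  with step.IH show ?case by (simp add: algebra_simps)
qed

lemma round_start_le_evas_powr: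
  defines "L \<equiv> \<lambda>n. log 2 (log 2 (evas n))"
  shows "round_start (Suc (Suc k)) + 1 \<le> 56.18 * evas k powr (4 - 1 / (L k)\<^sup>2)"
\<comment> \<open>For \<open>k = 0\<close> the sum stops at index 1, where
  \<open>sum_pow2_sqrt_le\<close> does not apply; here \<open>L 0 = 1\<close>, so the exponent is
  3.\<close>
proof (cases "k = 0")
  case True
  have "evas 0 = 4" by (simp add: evas_def)
  moreover have "log 2 4 = (2::real)" using log_pow_cancel[of 2 2] by simp
  ultimately have rhs: "evas 0 powr (4 - 1 / (L 0)\<^sup>2) = 64" by (simp add: L_def)
  have "sqrt 2 \<le> 17 / 12" by (rule real_le_lsqrt) (auto simp: power2_eq_square)
  then have "(2::real) powr (3 * (\<Sum>j\<le>Suc 0. 2 ^ j * sqrt (real j + 1))) \<le> 2 powr (11 + 1 / 2)"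
    by (intro powr_mono) auto
  also have "\<dots> = 2048 * sqrt 2"
    by (simp only: powr_add powr_half_sqrt) simp
  also have "\<dots> \<le> 2048 * (17 / 12)" using \<open>sqrt 2 \<le> 17 / 12\<close> by simp
  finally show ?thesis
    using round_start_Suc_le[of "Suc 0"] True rhs by (simp del: round_start.simps)
next
  case False
  define n where "n = Suc k"
  have n: "n \<ge> 2" using False by (simp add: n_def)
  define E where "E = 3 * 2 ^ k * sqrt (real n)"
  have evas: "evas k = 2 powr (E - 1)" by (simp add: evas_def E_def n_def add.commute)
  have "(3 * 2 ^ k :: real) * 1 \<le> E"
    unfolding E_def by (intro mult_left_mono) (auto simp: n_def)
  \<comment> \<open>\<open>3 * 2 ^ k\<close> is \<open>2 ^ n + 2 ^ k\<close>, which leaves room for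
    the 1; this gives \<open>L k \<ge> n\<close>.\<close>
  moreover have "(1::real) \<le> 2 ^ k" by simp
  ultimately have E: "2 ^ n \<le> E - 1" unfolding n_def power_Suc by linarith
  have E1: "E > 1" using E zero_less_power[of "2::real" n] by linarith
  have "real n = log 2 (2 ^ n)" by simp
  also have "\<dots> \<le> log 2 (E - 1)" using E E1 by (subst log_le_cancel_iff) auto
  finally have Ln: "real n \<le> L k" using evas by (simp add: L_def)
  have L2: "1 / (L k)\<^sup>2 \<le> 1 / (real n)\<^sup>2"
    using Ln n by (intro divide_left_mono power_mono) (auto intro!: mult_pos_pos)
  define F where "F = 2 ^ Suc n * (sqrt n - 1 / (4 * real n * sqrt n))"
  \<comment> \<open>The second-order term of \<open>F\<close> is exactly
    \<open>E / n\<^sup>2\<close>, which dominates the required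
    \<open>(E - 1) / (L k)\<^sup>2\<close>.\<close>
  have "3 * F = 4 * E - E * (1 / (real n)\<^sup>2)"
  proof -
    define q where "q = sqrt (real n)"
    have q: "real n = q * q" "q > 0" using n by (simp_all add: q_def)
    have "F = 2 ^ k * (4 * q - 1 / (q * q * q))"
      unfolding F_def q_def[symmetric] q(1) using q(2) by (simp add: n_def field_simps)
    then show ?thesis
      unfolding E_def q_def[symmetric] q(1) using q(2) by (simp add: field_simps power2_eq_square)
  qed
  also have "\<dots> \<le> 4 * E - (E - 1) * (1 / (L k)\<^sup>2)"
    using mult_mono[of "E - 1" E "1 / (L k)\<^sup>2" "1 / (real n)\<^sup>2"] L2 E1 by simp
  finally have F: "3 * F - 4 \<le> (E - 1) * (4 - 1 / (L k)\<^sup>2)" by (simp add: algebra_simps)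
  \<comment> \<open>The slack 1/2 contributes 3/2 and the shift from \<open>E\<close> to
    \<open>E - 1\<close> contributes 4. The final constant is 9/8 * 32 * 17/12 = 51.\<close>
  have "(2::real) powr (3 * (\<Sum>j\<le>n. 2 ^ j * sqrt (real j + 1))) \<le> 2 powr ((5 + 1 / 2) + (3 * F - 4))"
    using sum_pow2_sqrt_le[OF n] by (intro powr_mono) (auto simp: F_def)
  also have "\<dots> = 32 * sqrt 2 * 2 powr (3 * F - 4)"
    by (simp only: powr_add powr_half_sqrt) simp
  also have "\<dots> \<le> (32 * (17 / 12)) * 2 powr ((E - 1) * (4 - 1 / (L k)\<^sup>2))"
  proof (intro mult_mono powr_mono F)
    show "sqrt 2 \<le> 17 / 12" by (rule real_le_lsqrt) (auto simp: power2_eq_square)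
  qed auto
  also have "2 powr ((E - 1) * (4 - 1 / (L k)\<^sup>2)) = evas k powr (4 - 1 / (L k)\<^sup>2)"
    by (simp add: evas powr_powr)
  finally have "round_start (Suc n) + 1 \<le> 9 / 8 * (32 * (17 / 12) * evas k powr (4 - 1 / (L k)\<^sup>2))"
    using round_start_Suc_le[of n] by linarith
  also have "\<dots> \<le> 56.18 * evas k powr (4 - 1 / (L k)\<^sup>2)" by simp
  finally show ?thesis by (simp add: n_def del: round_start.simps)
qed

text \<open>Base and exponent both grow; \<open>x \<ge> 4\<close> makes the iterated logarithm at
  least 1, so the exponent is at least 3.\<close>

lemma powr_loglog_mono:
  fixes x y :: real
  assumes "4 \<le> x" "x \<le> y"
  shows "x powr (4 - 1 / (log 2 (log 2 x))\<^sup>2) \<le> y powr (4 - 1 / (log 2 (log 2 y))\<^sup>2)"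
proof -
  have "log 2 4 = (2::real)" using log_pow_cancel[of 2 2] by simp
  then have x: "2 \<le> log 2 x" using assms log_le_cancel_iff[of 2 4 x] by simp
  have xy: "log 2 x \<le> log 2 y" using assms by simp
  have "1 \<le> log 2 (log 2 x)" using x log_le_cancel_iff[of 2 2 "log 2 x"] by simp
  moreover have "log 2 (log 2 x) \<le> log 2 (log 2 y)" using x xy by simp
  ultimately have inv: "1 / (log 2 (log 2 y))\<^sup>2 \<le> 1 / (log 2 (log 2 x))\<^sup>2"
      "1 / (log 2 (log 2 x))\<^sup>2 \<le> 1"
    by (auto intro!: divide_left_mono power_mono mult_pos_pos)
  have "x powr (4 - 1 / (log 2 (log 2 x))\<^sup>2) \<le> y powr (4 - 1 / (log 2 (log 2 x))\<^sup>2)"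
    using assms inv by (intro powr_mono2) auto
  also have "\<dots> \<le> y powr (4 - 1 / (log 2 (log 2 y))\<^sup>2)"
    using assms inv by (intro powr_mono) auto
  finally show ?thesis .
qed

theorem theorem3:
  fixes u d :: real
  assumes "u \<ge> 1" and "d \<ge> 1"
  shows "comp_ratio search_strategy u d \<le>
    ereal (if u * d \<le> 4 then 1 + 8 / d
           else 1 + 1 / d * (56.18 * (u * d) powr (4 - 1 / (log 2 (log 2 (u * d)))\<^sup>2) - 1))"
proof (cases "u * d \<le> 4")
  case True
  have "evas 0 = 4" by (simp add: evas_def)
  then show ?thesis using comp_ratio_le_round[OF assms, of 0] True by simp
next
  case False
  define n where "n = (LEAST n. u * d \<le> evas n)"
  have n: "u * d \<le> evas n"
    unfolding n_def using evas_unbounded by (rule LeastI_ex)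
  have "evas 0 = 4" by (simp add: evas_def)
  \<comment> \<open>As \<open>u * d > evas 0\<close>, the least \<open>n\<close> has a predecessor
    \<open>k\<close>, and minimality gives \<open>evas k < u * d\<close>.\<close>
  with n False obtain k where k: "n = Suc k" by (cases n) auto
  have "evas k < u * d" using not_less_Least[of k "\<lambda>n. u * d \<le> evas n"] k n_def by auto
  then have "evas k powr (4 - 1 / (log 2 (log 2 (evas k)))\<^sup>2)
      \<le> (u * d) powr (4 - 1 / (log 2 (log 2 (u * d)))\<^sup>2)"
    using evas_ge_4[of k] by (intro powr_loglog_mono) auto
  then have "round_start (Suc n)
      \<le> 56.18 * (u * d) powr (4 - 1 / (log 2 (log 2 (u * d)))\<^sup>2) - 1"
    using round_start_le_evas_powr[of k] unfolding k by (simp del: round_start.simps)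
  then have "1 + round_start (Suc n) / d
      \<le> 1 + 1 / d * (56.18 * (u * d) powr (4 - 1 / (log 2 (log 2 (u * d)))\<^sup>2) - 1)"
    using assms by (simp add: divide_right_mono del: round_start.simps)
  then show ?thesis
    using order_trans[OF comp_ratio_le_round[OF assms n]] False
    by (simp del: round_start.simps)
qed

end
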